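(* There exists a norm $|||\cdot|||$ on $\ell_\infty$, equivalent to the usual supremum norm $\|\cdot\|_\infty$, such that the Banach space $(\ell_\infty,|||\cdot|||)$ is almost square (ASQ).
   Context: All Banach spaces are real. $\ell_\infty$ is the space of bounded real sequences indexed by $\mathbb N$. $S_X$ denotes the unit sphere of a Banach space $X$. A Banach space $X$ is almost square (ASQ) if for every finite collection $x_1,\ldots,x_k\in S_X$ there exists a sequence $\{y_m\}_m$ in $S_X$ such that $\|y_m\|\to 1$ and $\|x_i\pm y_m\|\to 1$ as $m\to\infty$ (for both choices of sign) for every $i\in\{1,\ldots,k\}$. *)

theory Defs
  imports "HOL-Analysis.Analysis"
begin

(* The topology of nat is discrete, so every bounded sequence is a bounded continuous
   function, and this type is the space of all bounded real sequences; the type class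
   norm on it is the supremum norm (see the two lemmas below). *)
type_synonym linf = "nat \<Rightarrow>\<^sub>C real"

lemma range_apply_linf: "range (apply_bcontfun :: linf \<Rightarrow> nat \<Rightarrow> real) = {f. bounded (range f)}"
proof -
  have "continuous_on UNIV f" for f :: "nat \<Rightarrow> real"
    by (simp add: continuous_on_open_invariant open_discrete)
  then show ?thesis
    by (subst type_definition.Rep_range[OF type_definition_bcontfun]) (simp add: bcontfun_def)
qed

lemma norm_linf: "norm (x :: linf) = (SUP n. \<bar>x n\<bar>)"
  by (simp add: norm_bcontfun_def dist_bcontfun_def dist_real_def)

definition is_norm :: "('a::real_vector \<Rightarrow> real) \<Rightarrow> bool" where
  "is_norm N \<longleftrightarrow>
     (\<forall>x. 0 \<le> N x) \<and>
     (\<forall>x. N x = 0 \<longleftrightarrow> x = 0) \<and>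
     (\<forall>a x. N (a *\<^sub>R x) = \<bar>a\<bar> * N x) \<and>
     (\<forall>x y. N (x + y) \<le> N x + N y)"

definition is_banach_norm :: "('a::real_vector \<Rightarrow> real) \<Rightarrow> bool" where
  "is_banach_norm N \<longleftrightarrow> is_norm N \<and> Metric_space.mcomplete UNIV (\<lambda>x y. N (x - y))"

definition equivalent_norms :: "('a::real_vector \<Rightarrow> real) \<Rightarrow> ('a \<Rightarrow> real) \<Rightarrow> bool" where
  "equivalent_norms M N \<longleftrightarrow> (\<exists>c C. 0 < c \<and> 0 < C \<and> (\<forall>x. c * N x \<le> M x \<and> M x \<le> C * N x))"

(* The space 'a normed by N is almost square. As the y m are taken in the unit sphere,
   the condition that their norms tend to 1 is automatic; it is kept because it is
   customarily part of the definition. *)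
definition almost_square :: "('a::real_vector \<Rightarrow> real) \<Rightarrow> bool" where
  "almost_square N \<longleftrightarrow>
     (\<forall>k::nat. \<forall>x :: nat \<Rightarrow> 'a. (\<forall>i\<in>{1..k}. N (x i) = 1) \<longrightarrow>
       (\<exists>y :: nat \<Rightarrow> 'a.
          (\<forall>m. N (y m) = 1) \<and>
          (\<lambda>m. N (y m)) \<longlonglongrightarrow> 1 \<and>
          (\<forall>i\<in>{1..k}. (\<lambda>m. N (x i + y m)) \<longlonglongrightarrow> 1 \<and> (\<lambda>m. N (x i - y m)) \<longlonglongrightarrow> 1)))"

end

theory Submission
  imports Defs
begin

text \<open>
  Take a free ultrafilter limit \<open>glim\<close> on the bounded sequences: a norm-one linear functional that
  vanishes on the unit vectors \<open>e n\<close> and agrees to any given precision with some coordinate (with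
  arbitrarily large index), and with the \<^emph>\<open>same\<close> coordinate for finitely many sequences at once.
  Subtracting the limit splits \<open>\<ell>\<^sub>\<infinity>\<close> into the kernel of \<open>glim\<close> and the constant sequences, and the
  new norm is the maximum norm of this splitting:
    \<open>N x = max \<bar>glim x\<bar> \<parallel>x - glim x\<parallel>\<^sub>\<infinity>\<close>.

  What prevents the supremum norm from being almost square is that a sequence such as \<open>1\<close> may be
  large in every coordinate. In the new norm the coordinates that count are the \<open>x n - glim x\<close>, and
  these are small at a common index \<open>n\<close> for finitely many \<open>x\<close>. Adding \<open>\<plusminus>e n\<close> for such an \<open>n\<close> leaves
  \<open>glim x\<close> and all other coordinates alone and makes the \<open>n\<close>-th one at most \<open>1 + \<epsilon>\<close>; so
  \<open>N (x \<plusminus> e n) \<le> 1 + \<epsilon>\<close> when \<open>N x = 1\<close>, and the triangle inequality for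
  \<open>2 x = (x + e n) + (x - e n)\<close> turns this into the lower bound \<open>1 - \<epsilon>\<close> for both signs
  (lemma \<open>bump_estimates\<close>).

  The ultrafilter is needed only through the existence of the limits, so any proper filter refining
  the Frechet filter along which all bounded sequences converge will do. Tychonoff's theorem
  provides one (lemma \<open>refine_filter_to_converge\<close>). Since \<open>\<bar>glim x\<bar> \<le> \<parallel>x\<parallel>\<^sub>\<infinity>\<close>, the norm \<open>N\<close> is within a
  factor \<open>2\<close> of the supremum norm, from which it inherits completeness.
\<close>

section \<open>Generalized limits of bounded sequences\<close>

text \<open>
  The functions \<open>\<lambda>i. X i a\<close> lie in a product of compact intervals, so by Tychonoff's theorem they
  cluster along \<open>F\<close> at some point of it. The refinement of \<open>F\<close> adds the neighbourhoods of that
  cluster point, pulled back along \<open>a \<mapsto> (\<lambda>i. X i a)\<close>.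
\<close>
lemma refine_filter_to_converge:
  fixes X :: "'i \<Rightarrow> 'a \<Rightarrow> real"
  assumes bound: "\<And>i a. \<bar>X i a\<bar> \<le> B i" and "F \<noteq> bot"
  obtains G where "G \<le> F" "G \<noteq> bot" "\<And>i. \<exists>l. (X i \<longlongrightarrow> l) G"
proof -
  define ev where "ev = (\<lambda>a i. X i a)"
  define K where "K = (\<Pi>\<^sub>E i\<in>UNIV. {- B i..B i})"
  have "compact K"
    unfolding K_def compactin_euclidean_iff[symmetric] euclidean_product_topology[symmetric]
    by (simp add: compactin_PiE)
  moreover have "filtermap ev F \<noteq> bot"
    using \<open>F \<noteq> bot\<close> by (simp add: filtermap_bot_iff)
  moreover have "ev a \<in> K" for a
    using bound by (auto simp: K_def ev_def abs_le_iff minus_le_iff)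
  then have "eventually (\<lambda>p. p \<in> K) (filtermap ev F)"
    by (simp add: eventually_filtermap)
  ultimately obtain p where p: "inf (nhds p) (filtermap ev F) \<noteq> bot"
    unfolding compact_filter by blast
  define G where "G = inf F (filtercomap ev (nhds p))"
  have "G \<noteq> bot"
  proof
    assume "G = bot"
    then obtain Q R where "eventually Q F" "eventually R (nhds p)" "\<And>a. \<not> (Q a \<and> R (ev a))"
      unfolding G_def trivial_limit_def eventually_inf eventually_filtercomap by metis
    then have "eventually (\<lambda>q. \<not> R q) (filtermap ev F)"
      unfolding eventually_filtermap by (auto elim: eventually_mono)
    with \<open>eventually R (nhds p)\<close> have "eventually (\<lambda>_. False) (inf (nhds p) (filtermap ev F))"
      unfolding eventually_inf by blast
    with p show False
      by (simp add: trivial_limit_def)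
  qed
  moreover have "(X i \<longlongrightarrow> p i) G" for i
  proof -
    have "((\<lambda>q. q i) \<longlongrightarrow> p i) (at p)"
      using continuous_on_product_coordinates[of i] unfolding continuous_on_def by blast
    then have "((\<lambda>q. q i) \<longlongrightarrow> p i) (nhds p)"
      by (simp add: tendsto_nhds_iff)
    moreover have "filterlim ev (nhds p) G"
      unfolding G_def by (rule filterlim_mono[OF filterlim_filtercomap order_refl]) simp
    ultimately show ?thesis
      using filterlim_compose unfolding ev_def by fastforce
  qed
  moreover have "G \<le> F"
    by (simp add: G_def)
  ultimately show ?thesis
    using that by blast
qed

text \<open>
  A stand-in for a free ultrafilter. A functional that merely extends the limit from the convergent
  sequences, such as a Banach limit, would not do: the limit has to come from a filter, so that
  finitely many sequences are close to their limits at one common index.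
\<close>
locale generalized_limit =
  fixes F :: "nat filter"
  assumes proper: "F \<noteq> bot"
    and free: "F \<le> sequentially"
    and converges: "\<And>x :: linf. \<exists>l. (apply_bcontfun x \<longlongrightarrow> l) F"
begin

definition glim :: "linf \<Rightarrow> real" where
  "glim x = Lim F (apply_bcontfun x)"

lemma tendsto_glim: "(apply_bcontfun x \<longlongrightarrow> glim x) F"
  using converges[of x] tendsto_Lim[OF proper] unfolding glim_def by blast

lemma glim_eqI: "(apply_bcontfun x \<longlongrightarrow> l) F \<Longrightarrow> glim x = l"
  using tendsto_unique[OF proper tendsto_glim] .

lemma glim_add: "glim (x + y) = glim x + glim y"
  by (rule glim_eqI) (simp add: tendsto_add tendsto_glim)

lemma glim_scaleR: "glim (a *\<^sub>R x) = a * glim x"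
  by (rule glim_eqI) (simp add: tendsto_mult_left tendsto_glim)

lemma abs_glim_le_norm: "\<bar>glim x\<bar> \<le> norm x"
proof (rule tendsto_upperbound[OF _ _ proper])
  show "((\<lambda>n. \<bar>x n\<bar>) \<longlongrightarrow> \<bar>glim x\<bar>) F"
    by (intro tendsto_rabs tendsto_glim)
  show "\<forall>\<^sub>F n in F. \<bar>x n\<bar> \<le> norm x"
    using norm_bounded[of x] by simp
qed

lemma common_index_near_limits:
  fixes x :: "'i \<Rightarrow> linf"
  assumes "finite I" "0 < \<epsilon>"
  obtains n where "\<And>i. i \<in> I \<Longrightarrow> \<bar>x i n - glim (x i)\<bar> < \<epsilon>"
proof -
  have "\<forall>\<^sub>F n in F. \<bar>x i n - glim (x i)\<bar> < \<epsilon>" for i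
    using tendstoD[OF tendsto_glim \<open>0 < \<epsilon>\<close>] by (simp add: dist_real_def)
  then have "\<forall>\<^sub>F n in F. \<forall>i\<in>I. \<bar>x i n - glim (x i)\<bar> < \<epsilon>"
    by (simp add: eventually_ball_finite \<open>finite I\<close>)
  then show ?thesis
    using that eventually_happens'[OF proper] by blast
qed

section \<open>The norm that measures the distance to the limit\<close>

definition centered :: "linf \<Rightarrow> linf" where
  "centered x = x - const_bcontfun (glim x)"

lemma centered_apply: "centered x n = x n - glim x"
  by (simp add: centered_def)

lemma centered_add: "centered (x + y) = centered x + centered y"
  by (rule bcontfun_eqI) (simp add: centered_apply glim_add)

lemma centered_scaleR: "centered (a *\<^sub>R x) = a *\<^sub>R centered x"
  by (rule bcontfun_eqI)
    (simp add: centered_apply glim_scaleR right_diff_distrib)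

definition split_norm :: "linf \<Rightarrow> real" where
  "split_norm x = max \<bar>glim x\<bar> (norm (centered x))"

lemma norm_const: "norm (const_bcontfun c :: linf) \<le> \<bar>c\<bar>"
  by (rule norm_bound) simp

lemma norm_le_split_norm: "norm x \<le> 2 * split_norm x"
proof -
  have "norm x = norm (centered x + const_bcontfun (glim x))"
    by (simp add: centered_def)
  also have "\<dots> \<le> norm (centered x) + \<bar>glim x\<bar>"
    using norm_triangle_ineq norm_const by (meson add_left_mono order_trans)
  finally show ?thesis
    by (simp add: split_norm_def)
qed

lemma split_norm_le_norm: "split_norm x \<le> 2 * norm x"
proof -
  have "norm (centered x) \<le> norm x + norm (const_bcontfun (glim x) :: linf)"
    unfolding centered_def by (rule norm_triangle_ineq4)
  then show ?thesis
    using norm_const[of "glim x"] abs_glim_le_norm[of x] by (simp add: split_norm_def)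
qed

lemma is_norm_split_norm: "is_norm split_norm"
  unfolding is_norm_def
proof (intro conjI allI)
  fix x y :: linf and a :: real
  show "0 \<le> split_norm x"
    by (simp add: split_norm_def)
  show "split_norm x = 0 \<longleftrightarrow> x = 0"
    using norm_le_split_norm[of x] split_norm_le_norm[of x] \<open>0 \<le> split_norm x\<close> by auto
  show "split_norm (a *\<^sub>R x) = \<bar>a\<bar> * split_norm x"
    by (simp add: split_norm_def glim_scaleR centered_scaleR abs_mult max_mult_distrib_left)
  show "split_norm (x + y) \<le> split_norm x + split_norm y"
    using norm_triangle_ineq[of "centered x" "centered y"] abs_triangle_ineq[of "glim x" "glim y"]
    unfolding split_norm_def glim_add centered_add by linarith
qed

lemma equivalent_split_norm: "equivalent_norms split_norm norm"
  unfolding equivalent_norms_def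
proof (intro exI conjI allI)
  show "1 / 2 * norm x \<le> split_norm x" "split_norm x \<le> 2 * norm x" for x
    using norm_le_split_norm[of x] split_norm_le_norm[of x] by simp_all
qed simp_all

section \<open>Almost squareness\<close>

definition e :: "nat \<Rightarrow> linf" where
  "e n = Bcontfun (indicator {n})"

lemma e_apply: "e n k = indicator {n} k"
proof -
  have "bounded (range (indicator {n} :: nat \<Rightarrow> real))"
    by (rule boundedI[of _ 1]) (auto simp: indicator_def)
  then obtain z :: linf where "apply_bcontfun z = indicator {n}"
    using range_apply_linf by (metis (mono_tags) imageE mem_Collect_eq)
  then show ?thesis
    by (metis apply_bcontfun_inverse e_def)
qed

lemma glim_e: "glim (e n) = 0"
proof (rule glim_eqI)
  have "\<forall>\<^sub>F k in sequentially. e n k = 0"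
    using eventually_gt_at_top[of n] by eventually_elim (simp add: e_apply)
  then have "\<forall>\<^sub>F k in F. e n k = 0"
    using free by (simp add: le_filter_def)
  then show "(apply_bcontfun (e n) \<longlongrightarrow> 0) F"
    by (rule tendsto_eventually)
qed

lemma centered_e: "centered (e n) = e n"
  by (simp add: centered_def glim_e)

lemma split_norm_e: "split_norm (e n) = 1"
proof -
  have "norm (e n) \<le> 1"
    by (rule norm_bound) (simp add: e_apply indicator_def)
  moreover have "1 \<le> norm (e n)"
    using norm_bounded[of "e n" n] by (simp add: e_apply)
  ultimately show ?thesis
    by (simp add: split_norm_def glim_e centered_e)
qed

lemma split_norm_add_bump_le:
  assumes "split_norm x \<le> 1" "\<bar>x n - glim x\<bar> < \<epsilon>" "\<bar>s\<bar> = 1"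
  shows "split_norm (x + s *\<^sub>R e n) \<le> 1 + \<epsilon>"
proof -
  have "norm (centered (x + s *\<^sub>R e n)) \<le> 1 + \<epsilon>"
  proof (rule norm_bound)
    fix k
    have "\<bar>x k - glim x\<bar> \<le> 1"
      using norm_bounded[of "centered x" k] assms(1) by (simp add: split_norm_def centered_apply)
    then show "norm (centered (x + s *\<^sub>R e n) k) \<le> 1 + \<epsilon>"
      using assms(2,3)
      by (cases "k = n") (auto simp: centered_add centered_scaleR centered_e centered_apply e_apply)
  qed
  moreover have "\<bar>glim (x + s *\<^sub>R e n)\<bar> \<le> 1 + \<epsilon>"
    using assms(1,2) unfolding split_norm_def glim_add glim_scaleR glim_e by linarith
  ultimately show ?thesis
    by (simp add: split_norm_def)
qed

text \<open>
  The upper bounds hold because the bump changes a single, small coordinate of \<open>centered x\<close>; they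
  imply the lower bounds, because the two values average at least to \<open>split_norm x = 1\<close>.
\<close>
lemma bump_estimates:
  assumes "split_norm x = 1" "\<bar>x n - glim x\<bar> < \<epsilon>"
  shows "\<bar>split_norm (x + e n) - 1\<bar> \<le> \<epsilon>" "\<bar>split_norm (x - e n) - 1\<bar> \<le> \<epsilon>"
proof -
  have upper: "split_norm (x + e n) \<le> 1 + \<epsilon>" "split_norm (x - e n) \<le> 1 + \<epsilon>"
    using split_norm_add_bump_le[of x n \<epsilon> 1] split_norm_add_bump_le[of x n \<epsilon> "-1"] assms by auto
  have "2 = split_norm (2 *\<^sub>R x)"
    using is_norm_split_norm assms(1) by (simp add: is_norm_def)
  also have "2 *\<^sub>R x = (x + e n) + (x - e n)"
    by (simp add: scaleR_2)
  also have "split_norm \<dots> \<le> split_norm (x + e n) + split_norm (x - e n)"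
    using is_norm_split_norm unfolding is_norm_def by blast
  finally show "\<bar>split_norm (x + e n) - 1\<bar> \<le> \<epsilon>" "\<bar>split_norm (x - e n) - 1\<bar> \<le> \<epsilon>"
    using upper by linarith+
qed

lemma almost_square_split_norm: "almost_square split_norm"
  unfolding almost_square_def
proof (intro allI impI)
  fix k :: nat and x :: "nat \<Rightarrow> linf"
  assume x: "\<forall>i\<in>{1..k}. split_norm (x i) = 1"
  define \<epsilon> where "\<epsilon> m = 1 / real (Suc m)" for m
  have pos: "0 < \<epsilon> m" for m
    by (simp add: \<epsilon>_def)
  have "\<exists>n. \<forall>i\<in>{1..k}. \<bar>x i n - glim (x i)\<bar> < \<epsilon> m" for m
    using common_index_near_limits[OF finite_atLeastAtMost pos] by metis
  then obtain n where n: "\<And>m i. i \<in> {1..k} \<Longrightarrow> \<bar>x i (n m) - glim (x i)\<bar> < \<epsilon> m"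
    by metis
  have to_one: "f \<longlonglongrightarrow> 1" if "\<And>m. \<bar>f m - 1\<bar> \<le> \<epsilon> m" for f :: "nat \<Rightarrow> real"
  proof (rule LIM_zero_cancel, rule Lim_null_comparison)
    show "\<forall>\<^sub>F m in sequentially. norm (f m - 1) \<le> \<epsilon> m"
      using that by simp
    show "\<epsilon> \<longlonglongrightarrow> 0"
      unfolding \<epsilon>_def using LIMSEQ_inverse_real_of_nat by (simp add: inverse_eq_divide)
  qed
  show "\<exists>y. (\<forall>m. split_norm (y m) = 1) \<and> (\<lambda>m. split_norm (y m)) \<longlonglongrightarrow> 1 \<and>
      (\<forall>i\<in>{1..k}. (\<lambda>m. split_norm (x i + y m)) \<longlonglongrightarrow> 1 \<and> (\<lambda>m. split_norm (x i - y m)) \<longlonglongrightarrow> 1)"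
    using x n
    by (intro exI[of _ "\<lambda>m. e (n m)"] conjI ballI to_one bump_estimates)
      (auto simp: split_norm_e less_imp_le[OF pos])
qed

end

section \<open>Completeness\<close>

lemma is_norm_Metric_space:
  assumes "is_norm N"
  shows "Metric_space UNIV (\<lambda>x y. N (x - y))"
proof
  fix x y z
  have N: "N (a *\<^sub>R u) = \<bar>a\<bar> * N u" "N (u + v) \<le> N u + N v" "0 \<le> N u" "N u = 0 \<longleftrightarrow> u = 0" for a u v
    using assms by (simp_all add: is_norm_def)
  show "0 \<le> N (x - y)" "N (x - y) = 0 \<longleftrightarrow> x = y"
    by (simp_all add: N)
  show "N (x - y) = N (y - x)"
    using N(1)[of "-1" "x - y"] by simp
  show "N (x - z) \<le> N (x - y) + N (y - z)"
    using N(2)[of "x - y" "y - z"] by simp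
qed

text \<open>
  Uniform limits of bounded continuous functions are bounded and continuous on any topological
  space, so for sequences the discrete topology of \<open>nat\<close> suffices: no metric on \<open>nat\<close> enters.
\<close>
lemma Cauchy_convergent_bcontfun:
  fixes f :: "nat \<Rightarrow> 'a::topological_space \<Rightarrow>\<^sub>C 'b::complete_space"
  assumes "Cauchy f"
  shows "convergent f"
proof -
  have "uniformly_Cauchy_on UNIV (\<lambda>n. apply_bcontfun (f n))"
    using assms unfolding uniformly_Cauchy_on_def Cauchy_def
    by (meson dist_fun_lt_imp_dist_val_lt)
  then obtain g where "uniform_limit UNIV f g sequentially"
    using Cauchy_uniformly_convergent unfolding uniformly_convergent_on_def by blast
  then show ?thesis
    by (rule uniform_limit_bcontfunE) (auto intro: convergentI)
qed

lemma is_banach_norm_if_equivalent: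
  fixes N :: "'a::real_normed_vector \<Rightarrow> real"
  assumes "is_norm N" "equivalent_norms N norm"
    and complete: "\<And>\<sigma> :: nat \<Rightarrow> 'a. Cauchy \<sigma> \<Longrightarrow> convergent \<sigma>"
  shows "is_banach_norm N"
proof -
  interpret Metric_space UNIV "\<lambda>x y. N (x - y)"
    using assms(1) by (rule is_norm_Metric_space)
  obtain c C where "0 < c" "0 < C" and cC: "\<And>x. c * norm x \<le> N x" "\<And>x. N x \<le> C * norm x"
    using assms(2) unfolding equivalent_norms_def by blast
  have "\<exists>l. limitin mtopology \<sigma> l sequentially" if "MCauchy \<sigma>" for \<sigma>
  proof -
    have "Cauchy \<sigma>"
      unfolding Cauchy_def dist_norm
    proof (intro allI impI)
      fix \<epsilon> :: real assume "0 < \<epsilon>"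
      then have "0 < c * \<epsilon>"
        using \<open>0 < c\<close> by simp
      then obtain M where "\<And>m n. M \<le> m \<Longrightarrow> M \<le> n \<Longrightarrow> N (\<sigma> m - \<sigma> n) < c * \<epsilon>"
        using \<open>MCauchy \<sigma>\<close> unfolding MCauchy_def by blast
      then have "c * norm (\<sigma> m - \<sigma> n) < c * \<epsilon>" if "M \<le> m" "M \<le> n" for m n
        using that cC(1) le_less_trans by blast
      then show "\<exists>M. \<forall>m\<ge>M. \<forall>n\<ge>M. norm (\<sigma> m - \<sigma> n) < \<epsilon>"
        using \<open>0 < c\<close> by (metis mult_less_cancel_left_pos)
    qed
    then obtain l where "\<sigma> \<longlonglongrightarrow> l"
      using complete convergent_def by blast
    then have "(\<lambda>n. C * norm (\<sigma> n - l)) \<longlonglongrightarrow> 0"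
      by (intro tendsto_mult_right_zero tendsto_norm_zero LIM_zero)
    then have "(\<lambda>n. N (\<sigma> n - l)) \<longlonglongrightarrow> 0"
      by (rule Lim_null_comparison[rotated]) (simp add: cC)
    then show ?thesis
      by (auto simp: limitin_metric_dist_null)
  qed
  then show ?thesis
    using assms(1) by (simp add: is_banach_norm_def mcomplete_def)
qed

section \<open>An almost square renorming\<close>

theorem theorem2p1:
  shows "\<exists>N :: linf \<Rightarrow> real.
    is_banach_norm N \<and> equivalent_norms N norm \<and> almost_square N"
proof -
  have "\<bar>apply_bcontfun x n\<bar> \<le> norm x" for x :: linf and n
    using norm_bounded[of x n] by simp
  then obtain F :: "nat filter"
    where "F \<le> sequentially" "F \<noteq> bot" "\<And>x :: linf. \<exists>l. (apply_bcontfun x \<longlongrightarrow> l) F"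
    using refine_filter_to_converge[of apply_bcontfun norm sequentially] sequentially_bot by blast
  then interpret generalized_limit F
    by unfold_locales
  show ?thesis
    using is_banach_norm_if_equivalent[OF is_norm_split_norm equivalent_split_norm Cauchy_convergent_bcontfun]
      equivalent_split_norm almost_square_split_norm by blast
qed

end
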